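(* Let the states $\mathbf q^{n,\ell},\mathbf q^{n+1,\ell}$ (with positive densities) satisfy, for $\ell=1,\dots,N$, the fully-discrete finite volume scheme $$\frac{\mathbf q^{n+1,\ell}-\mathbf q^{n,\ell}}{\Delta t}=-\frac{(\mathbf f_{\tilde{\mathbf p}}^{\ell+\frac12}-\mathbf f^\ell)-(\mathbf f_{\tilde{\mathbf p}}^{\ell-\frac12}-\mathbf f^\ell)}{\Delta x}+\frac{\mathbf g_{\tilde{\mathbf p}}^{\ell+\frac12}-\mathbf g_{\tilde{\mathbf p}}^{\ell-\frac12}}{\Delta x}+\tilde{\mathbf P}^\ell ,$$ with the fluxes $\mathbf f_{\tilde{\mathbf p}}^{\ell\pm\frac12}$, $\mathbf g_{\tilde{\mathbf p}}^{\ell\pm\frac12}$, the production term $\tilde{\mathbf P}^\ell$ and the averages $\tilde{\mathbf p}^\ell$ defined in the context. Then the scheme verifies the fully discrete energy conservation law $$\frac{\mathcal E^{n+1,\ell}-\mathcal E^{n,\ell}}{\Delta t}=-\frac1{\Delta x}\Big(\tilde D_{\mathcal E}^{\ell+\frac12,-}+\tilde D_{\mathcal E}^{\ell-\frac12,+}\Big)+\frac{g_{\mathcal E}^{\ell+\frac12}-g_{\mathcal E}^{\ell-\frac12}}{\Delta x},\qquad \ell=1,\dots,N,$$ where $\mathcal E^{n,\ell}=\mathcal E(\mathbf q^{n,\ell})$. The fluctuations are $$\tilde D_{\mathcal E}^{\ell+\frac12,-}=\tilde{\mathbf p}^\ell\cdot(\mathbf f_{\tilde{\mathbf p}}^{\ell+\frac12}-\mathbf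 f^\ell),\qquad \tilde D_{\mathcal E}^{\ell-\frac12,+}=\tilde{\mathbf p}^\ell\cdot(\mathbf f^\ell-\mathbf f_{\tilde{\mathbf p}}^{\ell-\frac12})$$ and they satisfy $$\tilde D_{\mathcal E}^{\ell+\frac12,-}+\tilde D_{\mathcal E}^{\ell+\frac12,+}=\tilde F^{\ell+1}-\tilde F^\ell=F(\tilde{\mathbf p}^{\ell+1})-F(\tilde{\mathbf p}^\ell).$$ The numerical viscosity flux is $$g_{\mathcal E}^{\ell+\frac12}=\frac12\,\frac{\epsilon^{\ell+\frac12}}{\Delta x}\,(\tilde{\mathbf p}^\ell+\tilde{\mathbf p}^{\ell+1})\cdot\partial^2_{\mathbf p\mathbf p}\tilde L^{\ell+\frac12}\,(\tilde{\mathbf p}^{\ell+1}-\tilde{\mathbf p}^\ell).$$ As a consequence, for vanishing jumps on the boundary (in the sense stated in the context), the scheme is nonlinearly marginally stable in the energy norm, i.e. $$\sum_{\ell=1}^N\Delta x\,\big(\mathcal E^{n+1,\ell}-\mathcal E^{n,\ell}\big)=0 .$$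
   Context: **Euler subsystem.** Constants $\gamma>1$, $c_v>0$. The state is $\mathbf q=(\rho,\rho v_1,\rho v_2,\rho v_3,\rho S)$ with $\rho>0$, and the total energy potential, as a function of $\mathbf q$, is $\mathcal E=\frac{\rho^\gamma}{\gamma-1}e^{S/c_v}+\frac12\rho v_iv_i$ (repeated index summed). The dual variables are $\mathbf p=\partial_{\mathbf q}\mathcal E=(\partial_\rho\mathcal E,v_1,v_2,v_3,T)$, with $T=\partial_{\rho S}\mathcal E=\frac{\rho^{\gamma-1}}{(\gamma-1)c_v}e^{S/c_v}$ and derivatives taken in the variables $\rho,\rho v_i,\rho S$. The map $\mathbf q\mapsto\mathbf p$ is a bijection from $\{\rho>0\}$ onto $\{T>0\}$, with inverse $\mathbf q(\mathbf p)$. The generating potential is $L=\mathbf p\cdot\mathbf q-\mathcal E$, regarded as a function of $\mathbf p$; it equals the pressure $p=\rho^\gamma e^{S/c_v}$. The physical flux in the $x$-direction is $\mathbf f=\partial_{\mathbf p}(v_1L)=(\rho v_1,\ \rho v_iv_1+p\,\delta_{i1},\ \rho Sv_1)$, regarded as a function of $\mathbf p$, and the energy flux is $F(\mathbf p)=\mathbf p\cdot\mathbf f(\mathbf p)-v_1L(\mathbf p)$. **Grid.** One-dimensional uniform grid with cells $\Omega^\ell=[x^{\ell-\frac12},x^{\ell+\frac12}]$, $\ell=1,\dots,N$, mesh size $\Delta x>0$, time step $\Delta t>0$; states in exterior cells $\ell=0,N+1$ at both time levels are prescribed. Numerical viscosities satisfy $\epsilon^{\ell+\frac12}\ge0$.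 **Averages.** For $\ell=0,\dots,N+1$, $$\tilde{\mathbf p}^\ell=\int_0^1\partial_{\mathbf q}\mathcal E\big(\mathbf q^{n,\ell}+s(\mathbf q^{n+1,\ell}-\mathbf q^{n,\ell})\big)\,ds,$$ with last component $\tilde T^\ell$. Write $\Delta\tilde{\mathbf p}^{\ell+\frac12}=\tilde{\mathbf p}^{\ell+1}-\tilde{\mathbf p}^\ell$, $\mathbf f^\ell=\mathbf f(\tilde{\mathbf p}^\ell)$, $\tilde F^\ell=F(\tilde{\mathbf p}^\ell)$. **Fluxes and production.** $$\mathbf f_{\tilde{\mathbf p}}^{\ell+\frac12}=\int_0^1\mathbf f\big(\tilde{\mathbf p}^\ell+s(\tilde{\mathbf p}^{\ell+1}-\tilde{\mathbf p}^\ell)\big)\,ds,\qquad \mathbf g_{\tilde{\mathbf p}}^{\ell+\frac12}=\epsilon^{\ell+\frac12}\,\partial^2_{\mathbf p\mathbf p}\tilde L^{\ell+\frac12}\,\frac{\tilde{\mathbf p}^{\ell+1}-\tilde{\mathbf p}^\ell}{\Delta x}.$$ Here $\partial^2_{\mathbf p\mathbf p}\tilde L^{\ell+\frac12}$ denotes the inverse of the Roe-type matrix $\int_0^1\partial^2_{\mathbf q\mathbf q}\mathcal E\big(\tilde{\mathbf q}^\ell+s(\tilde{\mathbf q}^{\ell+1}-\tilde{\mathbf q}^\ell)\big)ds$, with $\tilde{\mathbf q}^\ell=\mathbf q(\tilde{\mathbf p}^\ell)$. The production term is $\tilde{\mathbf P}^\ell=(0,\mathbf 0,\tilde\Pi^\ell)^T$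 with $\tilde\Pi^\ell$ determined by $$\tilde{\mathbf p}^\ell\cdot\tilde{\mathbf P}^\ell=\tilde T^\ell\tilde\Pi^\ell=\tfrac12\epsilon^{\ell+\frac12}\frac{\Delta\tilde{\mathbf p}^{\ell+\frac12}}{\Delta x}\cdot\partial^2_{\mathbf p\mathbf p}\tilde L^{\ell+\frac12}\frac{\Delta\tilde{\mathbf p}^{\ell+\frac12}}{\Delta x}+\tfrac12\epsilon^{\ell-\frac12}\frac{\Delta\tilde{\mathbf p}^{\ell-\frac12}}{\Delta x}\cdot\partial^2_{\mathbf p\mathbf p}\tilde L^{\ell-\frac12}\frac{\Delta\tilde{\mathbf p}^{\ell-\frac12}}{\Delta x}.$$ **Vanishing boundary jumps.** The solution is constant at the boundary: $\tilde{\mathbf p}^0=\tilde{\mathbf p}^1=\tilde{\mathbf p}^N=\tilde{\mathbf p}^{N+1}$. *)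

theory Defs
  imports "HOL-Analysis.Analysis"
begin

definition gradient :: "(real^'n \<Rightarrow> real) \<Rightarrow> real^'n \<Rightarrow> real^'n" where
  "gradient f x = (\<chi> i. frechet_derivative f (at x) (axis i 1))"

definition hessian :: "(real^'n \<Rightarrow> real) \<Rightarrow> real^'n \<Rightarrow> real^'n^'n" where
  "hessian f x = jacobian (gradient f) (at x)"

definition segment_mean ::
    "('a::real_vector \<Rightarrow> 'b::euclidean_space) \<Rightarrow> 'a \<Rightarrow> 'a \<Rightarrow> 'b" where
  "segment_mean g a b = integral {0..1} (\<lambda>s. g (a + s *\<^sub>R (b - a)))"

text \<open>A state is \<open>q = (\<rho>, \<rho> v1, \<rho> v2, \<rho> v3, \<rho> S)\<close>, stored in the components 1 to 5; the
  velocity and the specific entropy are therefore quotients by the first component.\<close>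

definition states :: "(real^5) set" where
  "states = {q. q $ 1 > 0}"

definition energy :: "real \<Rightarrow> real \<Rightarrow> real^5 \<Rightarrow> real" where
  "energy \<gamma> cv q =
     (q $ 1) powr \<gamma> / (\<gamma> - 1) * exp ((q $ 5 / q $ 1) / cv)
     + 1/2 * q $ 1 * (\<Sum>i\<in>{2,3,4}. (q $ i / q $ 1)\<^sup>2)"

definition dual :: "real \<Rightarrow> real \<Rightarrow> real^5 \<Rightarrow> real^5" where
  "dual \<gamma> cv = gradient (energy \<gamma> cv)"

text \<open>The components of a dual vector \<open>p\<close> are \<open>\<partial>\<^sub>\<rho>E, v1, v2, v3, T\<close>; in particular \<open>p $ 2\<close> is the
  velocity in the x-direction and \<open>p $ 5\<close> the temperature.  All functions of \<open>p\<close> below are only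
  meaningful on the open half-space \<open>p $ 5 > 0\<close>, the image of \<^term>\<open>states\<close> under \<^const>\<open>dual\<close>.\<close>

definition primal :: "real \<Rightarrow> real \<Rightarrow> real^5 \<Rightarrow> real^5" where
  "primal \<gamma> cv = the_inv_into states (dual \<gamma> cv)"

definition gen_potential :: "real \<Rightarrow> real \<Rightarrow> real^5 \<Rightarrow> real" where
  "gen_potential \<gamma> cv p = p \<bullet> primal \<gamma> cv p - energy \<gamma> cv (primal \<gamma> cv p)"

definition flux :: "real \<Rightarrow> real \<Rightarrow> real^5 \<Rightarrow> real^5" where
  "flux \<gamma> cv = gradient (\<lambda>p. p $ 2 * gen_potential \<gamma> cv p)"

definition energy_flux :: "real \<Rightarrow> real \<Rightarrow> real^5 \<Rightarrow> real" where
  "energy_flux \<gamma> cv p = p \<bullet> flux \<gamma> cv p - p $ 2 * gen_potential \<gamma> cv p"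

text \<open>Interface quantities depend on the dual vectors \<open>pl\<close> and \<open>pr\<close> of the cells to the left and
  to the right of the interface.\<close>

definition num_flux :: "real \<Rightarrow> real \<Rightarrow> real^5 \<Rightarrow> real^5 \<Rightarrow> real^5" where
  "num_flux \<gamma> cv pl pr = segment_mean (flux \<gamma> cv) pl pr"

definition visc_matrix :: "real \<Rightarrow> real \<Rightarrow> real^5 \<Rightarrow> real^5 \<Rightarrow> real^5^5" where
  "visc_matrix \<gamma> cv pl pr =
     matrix_inv (segment_mean (hessian (energy \<gamma> cv)) (primal \<gamma> cv pl) (primal \<gamma> cv pr))"

definition visc_flux ::
    "real \<Rightarrow> real \<Rightarrow> real \<Rightarrow> real \<Rightarrow> real^5 \<Rightarrow> real^5 \<Rightarrow> real^5" where
  "visc_flux \<gamma> cv dx \<epsilon> pl pr =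
     \<epsilon> *\<^sub>R (visc_matrix \<gamma> cv pl pr *v ((pr - pl) /\<^sub>R dx))"

definition dissipation ::
    "real \<Rightarrow> real \<Rightarrow> real \<Rightarrow> real \<Rightarrow> real^5 \<Rightarrow> real^5 \<Rightarrow> real" where
  "dissipation \<gamma> cv dx \<epsilon> pl pr =
     \<epsilon> * (((pr - pl) /\<^sub>R dx) \<bullet> (visc_matrix \<gamma> cv pl pr *v ((pr - pl) /\<^sub>R dx)))"

definition energy_visc_flux ::
    "real \<Rightarrow> real \<Rightarrow> real \<Rightarrow> real \<Rightarrow> real^5 \<Rightarrow> real^5 \<Rightarrow> real" where
  "energy_visc_flux \<gamma> cv dx \<epsilon> pl pr =
     1/2 * (\<epsilon> / dx) * ((pl + pr) \<bullet> (visc_matrix \<gamma> cv pl pr *v (pr - pl)))"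

definition fluct_minus :: "real \<Rightarrow> real \<Rightarrow> real^5 \<Rightarrow> real^5 \<Rightarrow> real" where
  "fluct_minus \<gamma> cv pl pr = pl \<bullet> (num_flux \<gamma> cv pl pr - flux \<gamma> cv pl)"

definition fluct_plus :: "real \<Rightarrow> real \<Rightarrow> real^5 \<Rightarrow> real^5 \<Rightarrow> real" where
  "fluct_plus \<gamma> cv pl pr = pr \<bullet> (flux \<gamma> cv pr - num_flux \<gamma> cv pl pr)"

end

theory Submission
  imports Defs
begin

text \<open>
  The time average of the dual variables is chosen so that its inner product with
  \<open>q\<^sup>n\<^sup>+\<^sup>1 - q\<^sup>n\<close> is the energy increment, by the fundamental theorem of calculus along the segment
  between the two states. Testing the scheme with it gives the balance law, since the production
  term compensates exactly what is missing to make the viscous terms a difference of interface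
  fluxes. The fluctuations add up to the jump of the energy flux because \<open>f\<close> is the gradient of
  \<open>v\<^sub>1 L\<close>, so that the fundamental theorem applies again, now in the convex half-space \<open>T > 0\<close>; this
  needs \<open>L\<close> to be continuously differentiable, which is read off the explicit Legendre transform.
\<close>

section \<open>Coordinates in \<open>real^5\<close> and evaluation of gradients\<close>

lemma UNIV_5: "(UNIV :: 5 set) = {1, 2, 3, 4, 5}"
proof -
  have "card {1, 2, 3, 4, 5 :: 5} = CARD(5)" by simp
  then show ?thesis by (intro card_subset_eq[symmetric]) simp_all
qed
lemma sum_5: "sum f (UNIV::5 set) = f 1 + f 2 + f 3 + f 4 + f 5"
  unfolding UNIV_5 by (simp add: ac_simps)

lemma forall_5: "(\<forall>i::5. P i) \<longleftrightarrow> P 1 \<and> P 2 \<and> P 3 \<and> P 4 \<and> P 5"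
  unfolding ball_UNIV[symmetric] UNIV_5 by simp

lemma inner_5: "(x::real^5) \<bullet> y = x$1 * y$1 + x$2 * y$2 + x$3 * y$3 + x$4 * y$4 + x$5 * y$5"
  by (simp add: inner_vec_def sum_5)

text \<open>Uniqueness of the Frechet derivative makes the choice-based \<open>gradient\<close>
  computable: any candidate \<open>g\<close> with the right derivative is the gradient.\<close>

lemma gradient_eq:
  assumes "(f has_derivative (\<lambda>h. g \<bullet> h)) (at x)"
  shows "gradient f x = g"
proof -
  have "frechet_derivative f (at x) = (\<lambda>h. g \<bullet> h)"
    using frechet_derivative_at[OF assms] by simp
  then show ?thesis
    by (simp add: gradient_def vec_eq_iff inner_axis)
qed

section \<open>Means of vector fields along a segment\<close>

lemma segment_mem_convex:
  assumes "convex S" "a \<in> S" "b \<in> S" "s \<in> {0..1}"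
  shows "a + s *\<^sub>R (b - a) \<in> S"
  using convexD_alt[OF assms(1-3), of s] assms(4) by (simp add: algebra_simps)

lemma integrable_on_segment:
  fixes g :: "'a::real_normed_vector \<Rightarrow> 'b::euclidean_space"
  assumes "convex S" "continuous_on S g" "a \<in> S" "b \<in> S"
  shows "(\<lambda>s. g (a + s *\<^sub>R (b - a))) integrable_on {0..1::real}"
  by (intro integrable_continuous_interval continuous_on_compose2[OF assms(2)] continuous_intros)
     (use segment_mem_convex[OF assms(1,3,4)] in auto)

text \<open>By the chain rule, \<open>f\<close> along the segment has derivative
  \<open>g \<bullet> (b - a)\<close>; the constant factor \<open>b - a\<close> leaves the integral.
  It serves for the energy in time and for the flux potential in space.\<close>

lemma segment_mean_gradient:
  fixes f :: "real^'n \<Rightarrow> real"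
  assumes S: "convex S" "a \<in> S" "b \<in> S"
    and der: "\<And>x. x \<in> S \<Longrightarrow> (f has_derivative (\<lambda>h. g x \<bullet> h)) (at x)"
    and cont: "continuous_on S g"
  shows "segment_mean (gradient f) a b \<bullet> (b - a) = f b - f a"
proof -
  let ?\<phi> = "\<lambda>s::real. a + s *\<^sub>R (b - a)"
  note mem = segment_mem_convex[OF S]
  \<comment> \<open>The mean is formed with \<open>gradient f\<close>, which is known to be
    \<open>g\<close> only on \<open>S\<close>; convexity keeps the segment there.\<close>
  have "((\<lambda>s. g (?\<phi> s)) has_integral segment_mean (gradient f) a b) {0..1}"
  proof -
    have "(\<lambda>s. gradient f (?\<phi> s)) integrable_on {0..1} \<longleftrightarrow> (\<lambda>s. g (?\<phi> s)) integrable_on {0..1}"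
      by (intro integrable_cong gradient_eq der mem)
    moreover have "segment_mean (gradient f) a b = integral {0..1} (\<lambda>s. g (?\<phi> s))"
      unfolding segment_mean_def by (intro integral_cong gradient_eq der mem)
    ultimately show ?thesis
      using integrable_on_segment[OF S(1) cont S(2,3)] by (simp add: has_integral_integral)
  qed
  then have "((\<lambda>s. g (?\<phi> s) \<bullet> (b - a)) has_integral segment_mean (gradient f) a b \<bullet> (b - a)) {0..1}"
    by (rule has_integral_linear[OF _ bounded_linear_inner_left, unfolded o_def])
  moreover have "((\<lambda>s. g (?\<phi> s) \<bullet> (b - a)) has_integral f (?\<phi> 1) - f (?\<phi> 0)) {0..1}"
  proof (rule fundamental_theorem_of_calculus)
    fix s :: real assume s: "s \<in> {0..1}"
    have "((\<lambda>s. f (?\<phi> s)) has_derivative (\<lambda>t. g (?\<phi> s) \<bullet> (t *\<^sub>R (b - a)))) (at s within {0..1})"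
      by (rule has_derivative_compose[where f = ?\<phi>, OF _ der[OF mem[OF s]]])
         (auto intro!: derivative_eq_intros)
    then show "((\<lambda>s. f (?\<phi> s)) has_vector_derivative g (?\<phi> s) \<bullet> (b - a)) (at s within {0..1})"
      by (simp add: has_vector_derivative_def)
  qed simp
  ultimately show ?thesis
    by (simp add: has_integral_unique)
qed

text \<open>A continuous positive function has a strictly positive integral, and taking a component
  commutes with integration. This keeps averaged temperatures positive.\<close>

lemma segment_mean_nth_pos:
  fixes g :: "'a::real_normed_vector \<Rightarrow> real^'n"
  assumes S: "convex S" "a \<in> S" "b \<in> S" and cont: "continuous_on S g"
    and pos: "\<And>x. x \<in> S \<Longrightarrow> 0 < g x $ i"
  shows "0 < segment_mean g a b $ i"
proof -
  let ?\<phi> = "\<lambda>s::real. a + s *\<^sub>R (b - a)"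
  note mem = segment_mem_convex[OF S]
  have "continuous_on {0..1} (\<lambda>s. g (?\<phi> s) $ i)"
    by (intro continuous_on_component continuous_on_compose2[OF cont] continuous_intros)
       (use mem in auto)
  then have "integral {0..1} (\<lambda>s::real. 0) < integral {0..1} (\<lambda>s. g (?\<phi> s) $ i)"
    by (intro integral_less_real) (use mem pos in auto)
  also have "\<dots> = segment_mean g a b $ i"
    using integral_linear[OF integrable_on_segment[OF S(1) cont S(2,3)] bounded_linear_vec_nth[of i]]
    by (simp add: segment_mean_def o_def)
  finally show ?thesis by simp
qed

section \<open>Closed forms for the Euler variables\<close>

definition temperature :: "real \<Rightarrow> real \<Rightarrow> real^5 \<Rightarrow> real" where
  "temperature \<gamma> cv q = (q $ 1) powr (\<gamma> - 1) / ((\<gamma> - 1) * cv) * exp (q $ 5 / q $ 1 / cv)"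

text \<open>Closed form of \<open>dual\<close> on \<open>states\<close>; the first component is the
  density derivative at fixed momentum and fixed \<rho>S, not at fixed velocity and entropy.\<close>

definition dual_euler :: "real \<Rightarrow> real \<Rightarrow> real^5 \<Rightarrow> real^5" where
  "dual_euler \<gamma> cv q =
     (\<chi> i. if i = 1 then temperature \<gamma> cv q * (\<gamma> * cv - q $ 5 / q $ 1)
                      - (\<Sum>j\<in>{2,3,4}. (q $ j / q $ 1)\<^sup>2) / 2
           else if i = 5 then temperature \<gamma> cv q
           else q $ i / q $ 1)"

text \<open>Inverting the dual map: the first component of \<open>p\<close> is \<open>T (\<gamma> c\<^sub>v - S) - v\<^sup>2 / 2\<close>, which
  determines \<open>S\<close>; the formula for \<open>T\<close> then determines \<open>\<rho>\<close>.\<close>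

definition entropy_of_dual :: "real \<Rightarrow> real \<Rightarrow> real^5 \<Rightarrow> real" where
  "entropy_of_dual \<gamma> cv p = \<gamma> * cv - (p $ 1 + (\<Sum>j\<in>{2,3,4}. (p $ j)\<^sup>2) / 2) / p $ 5"

definition density_of_dual :: "real \<Rightarrow> real \<Rightarrow> real^5 \<Rightarrow> real" where
  "density_of_dual \<gamma> cv p =
     exp ((ln ((\<gamma> - 1) * cv * p $ 5) - entropy_of_dual \<gamma> cv p / cv) / (\<gamma> - 1))"

definition primal_euler :: "real \<Rightarrow> real \<Rightarrow> real^5 \<Rightarrow> real^5" where
  "primal_euler \<gamma> cv p =
     density_of_dual \<gamma> cv p *\<^sub>R
       (\<chi> i. if i = 1 then 1 else if i = 5 then entropy_of_dual \<gamma> cv p else p $ i)"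

text \<open>The ideal gas law: \<rho>^\<gamma> exp(S/cv) rewritten through density and
  temperature.\<close>

definition pressure_of_dual :: "real \<Rightarrow> real \<Rightarrow> real^5 \<Rightarrow> real" where
  "pressure_of_dual \<gamma> cv p = (\<gamma> - 1) * cv * density_of_dual \<gamma> cv p * p $ 5"

section \<open>The energy gradient on the convex set of states\<close>

lemma convex_states: "convex states"
  unfolding states_def using convex_halfspace_gt[of 0 "axis 1 1 :: real^5"]
  by (simp add: inner_axis')

lemma energy_has_derivative:
  assumes "\<gamma> > 1" "cv > 0" "q \<in> states"
  shows "(energy \<gamma> cv has_derivative (\<lambda>h. dual_euler \<gamma> cv q \<bullet> h)) (at q)"
proof -
  have q: "q $ 1 > 0" using assms(3) by (simp add: states_def)
  have expanded: "energy \<gamma> cv = (\<lambda>q. (q $ 1) powr \<gamma> / (\<gamma> - 1) * exp ((q $ 5 / q $ 1) / cv)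
     + 1/2 * q $ 1 * ((q $ 2 / q $ 1)\<^sup>2 + (q $ 3 / q $ 1)\<^sup>2 + (q $ 4 / q $ 1)\<^sup>2))"
    by (simp add: energy_def fun_eq_iff)
  have nth: "((\<lambda>q::real^5. q $ i) has_derivative (\<lambda>h. h $ i)) (at q)" for i
    by (rule bounded_linear_imp_has_derivative[OF bounded_linear_vec_nth])
  have quot: "((\<lambda>q::real^5. q $ i / q $ 1) has_derivative
      (\<lambda>h. (h $ i - q $ i / q $ 1 * h $ 1) / q $ 1)) (at q)" for i
    by (rule has_derivative_eq_rhs[OF has_derivative_divide[OF nth nth]])
       (use q in \<open>simp_all add: fun_eq_iff field_simps\<close>)
  have powr: "((\<lambda>q::real^5. q $ 1 powr \<gamma>) has_derivative
      (\<lambda>h. \<gamma> * q $ 1 powr (\<gamma> - 1) * h $ 1)) (at q)"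
    by (rule has_derivative_eq_rhs[OF has_derivative_powr[OF nth has_derivative_const]])
       (use q in \<open>simp_all add: fun_eq_iff powr_diff\<close>)
  \<comment> \<open>With the power and the exponential replaced by opaque constants, the comparison
    of derivatives becomes a rational identity.\<close>
  define \<rho> v R e where "\<rho> = q $ 1" and "v i = q $ i / q $ 1" and "R = q $ 1 powr (\<gamma> - 1)"
    and "e = exp (q $ 5 / q $ 1 / cv)" for i
  note defs = this
  have [simp]: "\<rho> \<noteq> 0" "cv \<noteq> 0" "\<gamma> - 1 \<noteq> 0" "\<gamma> \<noteq> 1" using q assms by (auto simp: defs)
  have eqs: "q $ 1 = \<rho>" "q $ i / \<rho> = v i" "\<rho> powr (\<gamma> - 1) = R" "\<rho> powr \<gamma> = \<rho> * R"
    "exp (v 5 / cv) = e" for i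
    using q by (auto simp: defs powr_diff)
  define k where "k = \<gamma> - 1"
  have [simp]: "k \<noteq> 0" and "\<gamma> = k + 1" using assms by (auto simp: k_def)
  show ?thesis
    unfolding expanded
    apply (rule has_derivative_eq_rhs)
     apply (rule nth quot powr has_derivative_const has_derivative_add has_derivative_mult
       has_derivative_power has_derivative_exp bounded_linear.has_derivative[OF bounded_linear_divide])+
    apply (simp add: fun_eq_iff inner_5 dual_euler_def temperature_def eqs)
    apply (simp add: \<open>\<gamma> = k + 1\<close> field_simps power2_eq_square)
    done
qed

lemma continuous_on_dual_euler:
  assumes "\<gamma> > 1" "cv > 0"
  shows "continuous_on states (dual_euler \<gamma> cv)"
proof -
  have "continuous_on states (temperature \<gamma> cv)"
    unfolding temperature_def[abs_def] using assms
    by (intro continuous_intros) (auto simp: states_def)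
  moreover have "continuous_on states (\<lambda>q. q $ i / q $ 1)" for i
    by (intro continuous_intros) (auto simp: states_def)
  ultimately have "continuous_on states (\<lambda>q. dual_euler \<gamma> cv q $ i)" for i
    by (cases "i = 1"; cases "i = 5") (simp_all add: dual_euler_def continuous_intros)
  then show ?thesis
    using continuous_on_vec_lambda[of states "\<lambda>i q. dual_euler \<gamma> cv q $ i"] by simp
qed

lemma dual_eq:
  assumes "\<gamma> > 1" "cv > 0" "q \<in> states"
  shows "dual \<gamma> cv q = dual_euler \<gamma> cv q"
  unfolding dual_def by (rule gradient_eq[OF energy_has_derivative[OF assms]])

section \<open>Inverse of the dual map\<close>

lemma primal_euler_dual_euler:
  assumes "\<gamma> > 1" "cv > 0" "q \<in> states"
  shows "primal_euler \<gamma> cv (dual_euler \<gamma> cv q) = q"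
proof -
  have q: "q $ 1 > 0" using assms(3) by (simp add: states_def)
  define T where "T = temperature \<gamma> cv q"
  have T: "T > 0" using assms q by (simp add: T_def temperature_def)
  have S: "entropy_of_dual \<gamma> cv (dual_euler \<gamma> cv q) = q $ 5 / q $ 1"
    using T by (simp add: entropy_of_dual_def dual_euler_def T_def[symmetric])
  have "(\<gamma> - 1) * cv * T = (q $ 1) powr (\<gamma> - 1) * exp (q $ 5 / q $ 1 / cv)"
    using assms by (simp add: T_def temperature_def)
  \<comment> \<open>Taking logarithms makes the formula for \<open>T\<close> linear in
    \<open>ln (q $ 1)\<close>, which is how \<open>density_of_dual\<close> solves for the
    density.\<close>
  then have "ln ((\<gamma> - 1) * cv * T) = (\<gamma> - 1) * ln (q $ 1) + q $ 5 / q $ 1 / cv"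
    using q by (simp add: ln_mult)
  then have \<rho>: "density_of_dual \<gamma> cv (dual_euler \<gamma> cv q) = q $ 1"
    unfolding density_of_dual_def S using q assms
    by (simp add: dual_euler_def T_def[symmetric])
  show ?thesis
    unfolding primal_euler_def \<rho> S
    using q by (simp add: vec_eq_iff forall_5 dual_euler_def)
qed

lemma dual_euler_primal_euler:
  assumes "\<gamma> > 1" "cv > 0" "p $ 5 > 0"
  shows "dual_euler \<gamma> cv (primal_euler \<gamma> cv p) = p"
proof -
  define \<rho> S where "\<rho> = density_of_dual \<gamma> cv p" and "S = entropy_of_dual \<gamma> cv p"
  have \<rho>: "\<rho> > 0" by (simp add: \<rho>_def density_of_dual_def)
  have "\<rho> powr (\<gamma> - 1) = exp (ln ((\<gamma> - 1) * cv * p $ 5) - S / cv)"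
    using assms by (simp add: powr_def \<rho>_def density_of_dual_def S_def)
  then have T: "temperature \<gamma> cv (primal_euler \<gamma> cv p) = p $ 5"
    using assms \<rho> by (simp add: exp_diff temperature_def primal_euler_def \<rho>_def[symmetric] S_def[symmetric])
  have "p $ 5 * (\<gamma> * cv - S) = p $ 1 + (\<Sum>j\<in>{2,3,4}. (p $ j)\<^sup>2) / 2"
    using assms(3) by (simp add: S_def entropy_of_dual_def)
  then show ?thesis
    using \<rho> by (simp add: dual_euler_def T vec_eq_iff forall_5)
      (simp add: primal_euler_def \<rho>_def[symmetric] S_def[symmetric])
qed

text \<open>Evaluating \<open>the_inv_into\<close> requires injectivity, supplied by the left
  inverse, and a preimage in \<open>states\<close>, supplied by the right inverse.\<close>

lemma primal_eq:
  assumes "\<gamma> > 1" "cv > 0" "p $ 5 > 0"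
  shows "primal \<gamma> cv p = primal_euler \<gamma> cv p"
proof -
  have "primal_euler \<gamma> cv p \<in> states"
    by (simp add: states_def primal_euler_def density_of_dual_def)
  moreover have "inj_on (dual \<gamma> cv) states"
    by (rule inj_on_inverseI[of _ "primal_euler \<gamma> cv"])
       (simp add: assms dual_eq primal_euler_dual_euler)
  ultimately show ?thesis
    unfolding primal_def
    by (intro the_inv_into_f_eq) (use assms in \<open>simp_all add: dual_eq dual_euler_primal_euler\<close>)
qed

section \<open>The Legendre transform and the physical flux\<close>

lemma gen_potential_eq:
  assumes "\<gamma> > 1" "cv > 0" "p $ 5 > 0"
  shows "gen_potential \<gamma> cv p = pressure_of_dual \<gamma> cv p"
proof -
  define \<rho> S where "\<rho> = density_of_dual \<gamma> cv p" and "S = entropy_of_dual \<gamma> cv p"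
  have \<rho>: "\<rho> > 0" by (simp add: \<rho>_def density_of_dual_def)
  have "\<rho> powr (\<gamma> - 1) = exp (ln ((\<gamma> - 1) * cv * p $ 5) - S / cv)"
    using assms by (simp add: powr_def \<rho>_def density_of_dual_def S_def)
  then have "\<rho> powr \<gamma> / \<rho> * exp (S / cv) = (\<gamma> - 1) * cv * p $ 5"
    using assms \<rho> by (simp add: exp_diff powr_diff)
  \<comment> \<open>The internal energy density equals \<rho> cv T.\<close>
  then have T: "\<rho> powr \<gamma> / (\<gamma> - 1) * exp (S / cv) = \<rho> * cv * p $ 5"
    using assms \<rho> by (simp add: field_simps)
  have p1: "p $ 1 = p $ 5 * (\<gamma> * cv - S) - (\<Sum>j\<in>{2,3,4}. (p $ j)\<^sup>2) / 2"
    using assms(3) by (simp add: S_def entropy_of_dual_def)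
  have "energy \<gamma> cv (primal_euler \<gamma> cv p) = \<rho> * cv * p $ 5 + 1/2 * \<rho> * (\<Sum>j\<in>{2,3,4}. (p $ j)\<^sup>2)"
    using \<rho> T by (simp add: energy_def primal_euler_def \<rho>_def[symmetric] S_def[symmetric])
  \<comment> \<open>In the Legendre transform the entropy and kinetic terms cancel, leaving \<gamma>
    \<rho> cv T - \<rho> cv T.\<close>
  then show ?thesis
    unfolding gen_potential_def primal_eq[OF assms] pressure_of_dual_def
    by (simp add: inner_5 primal_euler_def \<rho>_def[symmetric] S_def[symmetric] p1)
       (simp add: algebra_simps power2_eq_square)
qed

text \<open>Legendre duality: the gradient of the generating potential is the primal state. It is
  verified here on the closed forms.\<close>

lemma pressure_has_derivative:
  assumes "\<gamma> > 1" "cv > 0" "p $ 5 > 0"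
  shows "(pressure_of_dual \<gamma> cv has_derivative (\<lambda>h. primal_euler \<gamma> cv p \<bullet> h)) (at p)"
proof -
  define S where "S = entropy_of_dual \<gamma> cv p"
  have p1: "p $ 1 = p $ 5 * (\<gamma> * cv - S) - ((p $ 2)\<^sup>2 + (p $ 3)\<^sup>2 + (p $ 4)\<^sup>2) / 2"
    using assms(3) by (simp add: S_def entropy_of_dual_def)
  define T k where "T = p $ 5" and "k = \<gamma> - 1"
  have T [simp]: "T > 0" "T \<noteq> 0" "p $ 5 = T" and k [simp]: "k > 0" "k \<noteq> 0" "\<gamma> - 1 = k"
    and \<gamma>: "\<gamma> = k + 1" and [simp]: "cv \<noteq> 0"
    using assms by (auto simp: T_def k_def)
  have nth: "((\<lambda>p::real^5. p $ i) has_derivative (\<lambda>h. h $ i)) (at p)" for i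
    by (rule bounded_linear_imp_has_derivative[OF bounded_linear_vec_nth])
  note rules = nth has_derivative_const has_derivative_add has_derivative_diff
  have kin: "((\<lambda>p::real^5. p $ 1 + (\<Sum>j\<in>{2,3,4}. (p $ j)\<^sup>2) / 2) has_derivative
      (\<lambda>h. h $ 1 + p $ 2 * h $ 2 + p $ 3 * h $ 3 + p $ 4 * h $ 4)) (at p)"
    apply (rule has_derivative_eq_rhs)
     apply (rule rules has_derivative_sum has_derivative_power
       bounded_linear.has_derivative[OF bounded_linear_divide])+
    apply (simp add: fun_eq_iff field_simps)
    done
  \<comment> \<open>The quotient rule divides the numerator by \<open>T\<close> squared;
    \<open>p1\<close> shows this numerator to be \<open>T * (\<gamma> * cv - S)\<close>, so one
    power of \<open>T\<close> cancels.\<close>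
  have dS: "(entropy_of_dual \<gamma> cv has_derivative
      (\<lambda>h. ((\<gamma> * cv - S) * h $ 5 - (h $ 1 + p $ 2 * h $ 2 + p $ 3 * h $ 3 + p $ 4 * h $ 4)) / T))
      (at p)"
    unfolding entropy_of_dual_def[abs_def]
    apply (rule has_derivative_eq_rhs)
     apply (rule has_derivative_diff has_derivative_const has_derivative_divide kin nth)+
    apply simp
    apply (simp add: fun_eq_iff p1 field_simps power2_eq_square)
    done
  have lin: "((\<lambda>p::real^5. (\<gamma> - 1) * cv * p $ 5) has_derivative (\<lambda>h. (\<gamma> - 1) * cv * h $ 5)) (at p)"
    by (rule has_derivative_mult_right[OF nth])
  have dln: "((\<lambda>p::real^5. ln ((\<gamma> - 1) * cv * p $ 5)) has_derivative (\<lambda>h. h $ 5 / T)) (at p)"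
    by (rule has_derivative_eq_rhs[OF has_derivative_ln[OF _ lin]])
       (use assms in \<open>simp_all add: fun_eq_iff field_simps\<close>)
  show ?thesis
    unfolding pressure_of_dual_def[abs_def] density_of_dual_def
    apply (rule has_derivative_eq_rhs)
     apply (rule nth dS dln has_derivative_const has_derivative_diff has_derivative_mult
       has_derivative_exp bounded_linear.has_derivative[OF bounded_linear_divide])+
    apply (simp add: fun_eq_iff inner_5 primal_euler_def density_of_dual_def S_def[symmetric])
    apply (simp add: \<gamma> field_simps)
    done
qed
text \<open>The product rule together with Legendre duality gives the familiar Euler flux: advection
  of the state by v1 plus pressure in the x-momentum component, hence
  \<open>axis 2 1\<close>.\<close>

lemma potential_flux_has_derivative:
  assumes "\<gamma> > 1" "cv > 0" "p $ 5 > 0"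
  shows "((\<lambda>p. p $ 2 * gen_potential \<gamma> cv p) has_derivative
    (\<lambda>h. (p $ 2 *\<^sub>R primal_euler \<gamma> cv p + pressure_of_dual \<gamma> cv p *\<^sub>R axis 2 1) \<bullet> h)) (at p)"
proof -
  have "((\<lambda>p. p $ 2 * pressure_of_dual \<gamma> cv p) has_derivative
    (\<lambda>h. (p $ 2 *\<^sub>R primal_euler \<gamma> cv p + pressure_of_dual \<gamma> cv p *\<^sub>R axis 2 1) \<bullet> h)) (at p)"
    by (rule has_derivative_eq_rhs[OF has_derivative_mult[OF
          bounded_linear_imp_has_derivative[OF bounded_linear_vec_nth] pressure_has_derivative[OF assms]]])
       (simp add: fun_eq_iff inner_add_left inner_axis')
  \<comment> \<open>The potential is identified with the pressure only for positive temperature;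
    openness of that set lets the derivative carry over.\<close>
  moreover have "open {p::real^5. p $ 5 > 0}"
    by (intro open_Collect_less continuous_intros)
  ultimately show ?thesis
    by (rule has_derivative_transform_within_open) (use assms in \<open>auto simp: gen_potential_eq\<close>)
qed

lemma continuous_on_potential_flux_gradient:
  assumes "\<gamma> > 1" "cv > 0"
  shows "continuous_on {p. p $ 5 > 0}
    (\<lambda>p. p $ 2 *\<^sub>R primal_euler \<gamma> cv p + pressure_of_dual \<gamma> cv p *\<^sub>R axis 2 1)"
proof -
  let ?H = "{p::real^5. p $ 5 > 0}"
  have S: "continuous_on ?H (entropy_of_dual \<gamma> cv)"
    unfolding entropy_of_dual_def[abs_def] by (intro continuous_intros) auto
  have \<rho>: "continuous_on ?H (density_of_dual \<gamma> cv)"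
    unfolding density_of_dual_def[abs_def] using assms by (intro continuous_intros S) auto
  have vec: "continuous_on ?H (\<lambda>p. \<chi> i. if i = 1 then 1 else if i = 5 then entropy_of_dual \<gamma> cv p else p $ i)"
  proof (rule continuous_on_vec_lambda)
    fix i :: 5
    show "continuous_on ?H (\<lambda>p. if i = 1 then 1 else if i = 5 then entropy_of_dual \<gamma> cv p else p $ i)"
      using S by (cases "i = 1"; cases "i = 5") (auto intro!: continuous_intros)
  qed
  show ?thesis
    unfolding primal_euler_def[abs_def] pressure_of_dual_def[abs_def]
    by (intro \<rho> vec continuous_intros)
qed

section \<open>Discrete energy identities in time and across interfaces\<close>

lemma energy_diff_eq_dual_mean:
  assumes "\<gamma> > 1" "cv > 0" "a \<in> states" "b \<in> states"
  shows "segment_mean (dual \<gamma> cv) a b \<bullet> (b - a) = energy \<gamma> cv b - energy \<gamma> cv a"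
  unfolding dual_def
  by (rule segment_mean_gradient[OF convex_states assms(3,4)])
     (use assms in \<open>auto intro: energy_has_derivative continuous_on_dual_euler\<close>)

text \<open>Places the time averages in the half-space where the flux is a continuous gradient, so
  that interface segments stay inside it.\<close>

lemma dual_mean_temperature_pos:
  assumes "\<gamma> > 1" "cv > 0" "a \<in> states" "b \<in> states"
  shows "0 < segment_mean (dual \<gamma> cv) a b $ 5"
proof (rule segment_mean_nth_pos[OF convex_states assms(3,4)])
  show "continuous_on states (dual \<gamma> cv)"
    using continuous_on_dual_euler[OF assms(1,2)]
    by (rule continuous_on_eq) (simp add: dual_eq assms)
  show "0 < dual \<gamma> cv q $ 5" if "q \<in> states" for q
    using that assms by (simp add: dual_eq dual_euler_def temperature_def states_def)
qed

text \<open>Tadmor's condition for an entropy-conservative flux, satisfied because the interface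
  flux is the segment mean of a gradient.\<close>

lemma num_flux_potential_jump:
  assumes "\<gamma> > 1" "cv > 0" "pl $ 5 > 0" "pr $ 5 > 0"
  shows "num_flux \<gamma> cv pl pr \<bullet> (pr - pl) = pr $ 2 * gen_potential \<gamma> cv pr - pl $ 2 * gen_potential \<gamma> cv pl"
proof -
  have "convex {p::real^5. p $ 5 > 0}"
    using convex_halfspace_gt[of 0 "axis 5 1 :: real^5"] by (simp add: inner_axis')
  then show ?thesis
    unfolding num_flux_def flux_def
    by (rule segment_mean_gradient)
       (use assms in \<open>auto intro: potential_flux_has_derivative continuous_on_potential_flux_gradient\<close>)
qed

lemma fluctuations_sum:
  assumes "\<gamma> > 1" "cv > 0" "pl $ 5 > 0" "pr $ 5 > 0"
  shows "fluct_minus \<gamma> cv pl pr + fluct_plus \<gamma> cv pl pr = energy_flux \<gamma> cv pr - energy_flux \<gamma> cv pl"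
  using num_flux_potential_jump[OF assms]
  by (simp add: fluct_minus_def fluct_plus_def energy_flux_def inner_diff_right inner_diff_left inner_commute)

text \<open>The mean of \<open>pl\<close> and \<open>pr\<close> is \<open>pl\<close> plus, or
  \<open>pr\<close> minus, half the jump; that half jump paired with the viscous flux is
  \<open>dx / 2\<close> times the dissipation.\<close>

lemma
  assumes "dx \<noteq> 0"
  shows energy_visc_flux_left: "energy_visc_flux \<gamma> cv dx \<epsilon> pl pr =
      pl \<bullet> visc_flux \<gamma> cv dx \<epsilon> pl pr + dx / 2 * dissipation \<gamma> cv dx \<epsilon> pl pr"
    and energy_visc_flux_right: "energy_visc_flux \<gamma> cv dx \<epsilon> pl pr =
      pr \<bullet> visc_flux \<gamma> cv dx \<epsilon> pl pr - dx / 2 * dissipation \<gamma> cv dx \<epsilon> pl pr"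
proof -
  define w where "w = visc_matrix \<gamma> cv pl pr *v (pr - pl)"
  have w: "visc_matrix \<gamma> cv pl pr *v ((pr - pl) /\<^sub>R dx) = w /\<^sub>R dx"
    by (simp add: w_def matrix_vector_mult_scaleR)
  show "energy_visc_flux \<gamma> cv dx \<epsilon> pl pr =
      pl \<bullet> visc_flux \<gamma> cv dx \<epsilon> pl pr + dx / 2 * dissipation \<gamma> cv dx \<epsilon> pl pr"
    "energy_visc_flux \<gamma> cv dx \<epsilon> pl pr =
      pr \<bullet> visc_flux \<gamma> cv dx \<epsilon> pl pr - dx / 2 * dissipation \<gamma> cv dx \<epsilon> pl pr"
    unfolding energy_visc_flux_def visc_flux_def dissipation_def w w_def[symmetric]
    using assms by (simp_all add: inner_add_left inner_diff_left field_simps)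
qed

section \<open>Energy balance and its sum over the grid\<close>

theorem theorem3:
  fixes \<gamma> cv dx dt :: real
    and N :: nat
    and qn qn1 p P :: "nat \<Rightarrow> real^5"
    and \<theta> \<epsilon> :: "nat \<Rightarrow> real"
  assumes "\<gamma> > 1" and "cv > 0" and "dx > 0" and "dt > 0" and "N \<ge> 1"
    and "\<And>l. l \<in> {0..N} \<Longrightarrow> \<epsilon> l \<ge> 0"
    and "\<And>l. l \<in> {0..N+1} \<Longrightarrow> qn l \<in> states"
    and "\<And>l. l \<in> {0..N+1} \<Longrightarrow> qn1 l \<in> states"
    and "\<And>l. l \<in> {0..N+1} \<Longrightarrow> p l = segment_mean (dual \<gamma> cv) (qn l) (qn1 l)"
    and "\<And>l. l \<in> {1..N} \<Longrightarrow> P l = axis 5 (\<theta> l)"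
    and "\<And>l. l \<in> {1..N} \<Longrightarrow>
           p l $ 5 * \<theta> l =
             1/2 * dissipation \<gamma> cv dx (\<epsilon> l) (p l) (p (l+1))
             + 1/2 * dissipation \<gamma> cv dx (\<epsilon> (l-1)) (p (l-1)) (p l)"
    and "\<And>l. l \<in> {1..N} \<Longrightarrow>
           (qn1 l - qn l) /\<^sub>R dt =
             - (((num_flux \<gamma> cv (p l) (p (l+1)) - flux \<gamma> cv (p l))
                 - (num_flux \<gamma> cv (p (l-1)) (p l) - flux \<gamma> cv (p l))) /\<^sub>R dx)
             + (visc_flux \<gamma> cv dx (\<epsilon> l) (p l) (p (l+1))
                - visc_flux \<gamma> cv dx (\<epsilon> (l-1)) (p (l-1)) (p l)) /\<^sub>R dx
             + P l"
  shows "(\<forall>l\<in>{1..N}.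
            (energy \<gamma> cv (qn1 l) - energy \<gamma> cv (qn l)) / dt =
              - (1 / dx) * (fluct_minus \<gamma> cv (p l) (p (l+1)) + fluct_plus \<gamma> cv (p (l-1)) (p l))
              + (energy_visc_flux \<gamma> cv dx (\<epsilon> l) (p l) (p (l+1))
                 - energy_visc_flux \<gamma> cv dx (\<epsilon> (l-1)) (p (l-1)) (p l)) / dx)
       \<and> (\<forall>l\<in>{0..N}.
            fluct_minus \<gamma> cv (p l) (p (l+1)) + fluct_plus \<gamma> cv (p l) (p (l+1)) =
              energy_flux \<gamma> cv (p (l+1)) - energy_flux \<gamma> cv (p l))
       \<and> (p 0 = p 1 \<and> p 1 = p N \<and> p N = p (N+1) \<longrightarrow>
            (\<Sum>l=1..N. dx * (energy \<gamma> cv (qn1 l) - energy \<gamma> cv (qn l))) = 0)"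
proof (intro conjI ballI impI)
  have dx: "dx \<noteq> 0" using assms(3) by simp
  have pos: "p l $ 5 > 0" if "l \<in> {0..N+1}" for l
    using dual_mean_temperature_pos[OF assms(1,2)] assms(7,8,9) that by simp
  have fluct: "fluct_minus \<gamma> cv (p l) (p (l+1)) + fluct_plus \<gamma> cv (p l) (p (l+1)) =
      energy_flux \<gamma> cv (p (l+1)) - energy_flux \<gamma> cv (p l)" if "l \<in> {0..N}" for l
    using that by (intro fluctuations_sum assms(1,2) pos) auto
  then show "fluct_minus \<gamma> cv (p l) (p (l+1)) + fluct_plus \<gamma> cv (p l) (p (l+1)) =
      energy_flux \<gamma> cv (p (l+1)) - energy_flux \<gamma> cv (p l)" if "l \<in> {0..N}" for l
    using that .
  have balance: "(energy \<gamma> cv (qn1 l) - energy \<gamma> cv (qn l)) / dt =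
      - (1 / dx) * (fluct_minus \<gamma> cv (p l) (p (l+1)) + fluct_plus \<gamma> cv (p (l-1)) (p l))
      + (energy_visc_flux \<gamma> cv dx (\<epsilon> l) (p l) (p (l+1))
         - energy_visc_flux \<gamma> cv dx (\<epsilon> (l-1)) (p (l-1)) (p l)) / dx" if l: "l \<in> {1..N}" for l
  proof -
    have "p l \<bullet> (qn1 l - qn l) = energy \<gamma> cv (qn1 l) - energy \<gamma> cv (qn l)"
      using l energy_diff_eq_dual_mean[OF assms(1,2,7,8)] assms(9) by simp
    then have "(energy \<gamma> cv (qn1 l) - energy \<gamma> cv (qn l)) / dt = p l \<bullet> ((qn1 l - qn l) /\<^sub>R dt)"
      by (simp add: divide_inverse mult.commute)
    also have "\<dots> = - (1 / dx) * (fluct_minus \<gamma> cv (p l) (p (l+1)) + fluct_plus \<gamma> cv (p (l-1)) (p l))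
      + (p l \<bullet> visc_flux \<gamma> cv dx (\<epsilon> l) (p l) (p (l+1))
         - p l \<bullet> visc_flux \<gamma> cv dx (\<epsilon> (l-1)) (p (l-1)) (p l)) / dx + p l $ 5 * \<theta> l"
      unfolding assms(12)[OF l] assms(10)[OF l]
      by (simp add: fluct_minus_def fluct_plus_def inner_add_right inner_diff_right inner_axis
          divide_inverse algebra_simps)
    \<comment> \<open>The left form is used at the right interface and the right form at the left
      one. Their opposite signs turn the difference of fluxes into a sum of two half dissipations,
      which is exactly the production.\<close>
    also have "\<dots> = - (1 / dx) * (fluct_minus \<gamma> cv (p l) (p (l+1)) + fluct_plus \<gamma> cv (p (l-1)) (p l))
      + (energy_visc_flux \<gamma> cv dx (\<epsilon> l) (p l) (p (l+1))
         - energy_visc_flux \<gamma> cv dx (\<epsilon> (l-1)) (p (l-1)) (p l)) / dx"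
      unfolding assms(11)[OF l] energy_visc_flux_left[OF dx, of _ _ _ "p l" "p (l+1)"]
        energy_visc_flux_right[OF dx, of _ _ _ "p (l-1)" "p l"]
      using dx by (simp add: add_divide_distrib diff_divide_distrib)
    finally show ?thesis .
  qed
  then show "(energy \<gamma> cv (qn1 l) - energy \<gamma> cv (qn l)) / dt =
      - (1 / dx) * (fluct_minus \<gamma> cv (p l) (p (l+1)) + fluct_plus \<gamma> cv (p (l-1)) (p l))
      + (energy_visc_flux \<gamma> cv dx (\<epsilon> l) (p l) (p (l+1))
         - energy_visc_flux \<gamma> cv dx (\<epsilon> (l-1)) (p (l-1)) (p l)) / dx" if "l \<in> {1..N}" for l
    using that .
  assume bdry: "p 0 = p 1 \<and> p 1 = p N \<and> p N = p (N+1)"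
  \<comment> \<open>Index \<open>l\<close> denotes the interface to the right of cell
    \<open>l\<close> in \<open>fm\<close> and \<open>g\<close>, but the cell itself in
    \<open>F\<close>.\<close>
  define fm F g where "fm l = fluct_minus \<gamma> cv (p l) (p (l+1))" and "F l = energy_flux \<gamma> cv (p l)"
    and "g l = energy_visc_flux \<gamma> cv dx (\<epsilon> l) (p l) (p (l+1))" for l
  have "dx * (energy \<gamma> cv (qn1 l) - energy \<gamma> cv (qn l)) =
      dt * ((g l - F l - fm l) - (g (l - 1) - F (l - 1) - fm (l - 1)))" if l: "l \<in> {1..N}" for l
  proof -
    have pred: "l - 1 + 1 = l" "l - 1 \<in> {0..N}" using l by auto
    \<comment> \<open>Trading the plus fluctuation for the energy flux jump and the minus
      fluctuation on the same interface makes the balance a backward difference of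
      \<open>g - F - fm\<close>.\<close>
    have "fluct_plus \<gamma> cv (p (l-1)) (p l) = F l - F (l-1) - fm (l-1)"
      using fluct[OF pred(2)] by (simp only: pred(1) fm_def F_def)
    then have "(energy \<gamma> cv (qn1 l) - energy \<gamma> cv (qn l)) / dt =
        ((g l - F l - fm l) - (g (l - 1) - F (l - 1) - fm (l - 1))) / dx"
      unfolding balance[OF l] fm_def g_def pred(1)
      by (simp add: diff_divide_distrib add_divide_distrib)
    then show ?thesis
      using assms(3,4) by (simp add: field_simps)
  qed
  then have "(\<Sum>l=1..N. dx * (energy \<gamma> cv (qn1 l) - energy \<gamma> cv (qn l)))
      = dt * (\<Sum>l=1..N. (g l - F l - fm l) - (g (l - 1) - F (l - 1) - fm (l - 1)))"
    by (simp add: sum_distrib_left)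
  also have "\<dots> = dt * ((g N - F N - fm N) - (g 0 - F 0 - fm 0))"
    using sum_telescope''[of 0 N "\<lambda>l. g l - F l - fm l"] by simp
  \<comment> \<open>Zero jumps make \<open>g 0\<close> and \<open>g N\<close> vanish even if
    \<open>\<epsilon> 0\<close> and \<open>\<epsilon> N\<close> differ; \<open>F\<close> and
    \<open>fm\<close> have equal arguments at both ends and cancel.\<close>
  also have "\<dots> = 0"
    using bdry by (simp add: g_def F_def fm_def energy_visc_flux_def)
  finally show "(\<Sum>l=1..N. dx * (energy \<gamma> cv (qn1 l) - energy \<gamma> cv (qn l))) = 0" .
qed

end
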